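(* Let $D$ be a finite nonempty set of days and, for each $d\in D$, let $\mathcal J_d$ be a finite set of surgeries (the sets being disjoint), with standard deviations $\sigma_j>0$ and bounds $0<\underline\alpha_j<\bar\alpha_j<1$. Consider the three fixed-schedule relaxations M1, M2, M3 defined in the context, in which capacity is priced uniformly across rooms, surgeons, and days. Let $\alpha^*$ be an optimal solution of one of them (with $r^*$ in the case of M2), together with its Lagrange (KKT) multipliers: in M2, $\eta_d$ for the constraint $G_d(\alpha)\le r$; in M3, $\xi_d$ for the constraint $G_d(\alpha)\le B_d$. Then for any day $d$ with positive day-level reliability price $\lambda_d$, every interior surgery $j\in\mathcal J_d$ (i.e. $\underline\alpha_j<\alpha_j^*<\bar\alpha_j$) satisfies $$\sigma_j\,\varphi(\alpha_j^* )=\lambda_d,\qquad\text{equivalently}\qquad \alpha_j^*=\varphi^{-1}(\lambda_d/\sigma_j),$$ with $$\lambda_d=\begin{cases} w_\varepsilon/|D| & \text{in M1},\\ \eta_d & \text{in M2},\\ \xi_d & \text{in M3}.\end{cases}$$ Here $\eta_d\ge 0$, $\sum_{d}\eta_d=w_\varepsilon$, and $\eta_d(G_d(\alpha^* )-r^* )=0$ for all $d$ in M2, while $\xi_d\ge0$ and $\xi_d(G_d(\alpha^* )-B_d)=0$ for all $d$ in M3. Days with zero price are boundary cases: the relaxation assigns no marginal value to additional reliability on those days, so the interior rule does not apply.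
   Context: For $\alpha\in(0,1)$ let $\kappa(\alpha)=\sqrt{(1-\alpha)/\alpha}$ and $\varphi(\alpha)=\dfrac{(1-\alpha)^{1/2}}{2\alpha^{3/2}}$, a strictly decreasing bijection from $(0,1)$ onto $(0,\infty)$. The schedule (day, room, and order of each surgery) is fixed and only the tail probabilities $\alpha_j$ of the surgeries are chosen; $\sigma_j\kappa(\alpha_j)$ is the buffer time of surgery $j$. Let $\mathcal A=\prod_{d\in D}\prod_{j\in\mathcal J_d}[\underline\alpha_j,\bar\alpha_j]$ and, for $\alpha\in\mathcal A$, $$W_d(\alpha)=\sum_{j\in\mathcal J_d}\sigma_j\kappa(\alpha_j),\quad G_d(\alpha)=\sum_{j\in\mathcal J_d}-\log(1-\alpha_j),\quad F(\alpha)=\sum_{d\in D}W_d(\alpha).$$ Given a reliability weight $w_\varepsilon$ and day targets $B_d$, the relaxations are: M1: $\min_{\alpha\in\mathcal A} F(\alpha)+\frac{w_\varepsilon}{|D|}\sum_{d}G_d(\alpha)$. M2: $\min_{\alpha\in\mathcal A,\ r} F(\alpha)+w_\varepsilon r$ subject to $G_d(\alpha)\le r$ for all $d\in D$. M3: $\min_{\alpha\in\mathcal A}F(\alpha)$ subject to $G_d(\alpha)\le B_d$ for all $d\in D$. Capacity being priced uniformly means that every buffer minute $\sigma_j\kappa(\alpha_j)$ enters the objective $F$ with the same unit price. *)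

theory Defs
  imports "HOL-Analysis.Analysis"
begin

definition kappa :: "real \<Rightarrow> real" where
  "kappa a = sqrt ((1 - a) / a)"

definition phi :: "real \<Rightarrow> real" where
  "phi a = (1 - a) powr (1/2) / (2 * a powr (3/2))"

definition phi_inv :: "real \<Rightarrow> real" where
  "phi_inv = the_inv_into {0<..<1} phi"

text \<open>A day \<open>d\<close> has the set \<open>J d\<close> of surgeries; tail probabilities are functions on the
  surgeries of all days, taken as elements of the extensional product.\<close>

definition surgeries :: "'d set \<Rightarrow> ('d \<Rightarrow> 'j set) \<Rightarrow> 'j set" where
  "surgeries D J = (\<Union>d\<in>D. J d)"

definition alpha_box ::
  "'d set \<Rightarrow> ('d \<Rightarrow> 'j set) \<Rightarrow> ('j \<Rightarrow> real) \<Rightarrow> ('j \<Rightarrow> real) \<Rightarrow> ('j \<Rightarrow> real) set" where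
  "alpha_box D J lo hi = (\<Pi>\<^sub>E j\<in>surgeries D J. {lo j..hi j})"

definition W :: "('d \<Rightarrow> 'j set) \<Rightarrow> ('j \<Rightarrow> real) \<Rightarrow> 'd \<Rightarrow> ('j \<Rightarrow> real) \<Rightarrow> real" where
  "W J \<sigma> d \<alpha> = (\<Sum>j\<in>J d. \<sigma> j * kappa (\<alpha> j))"

definition G :: "('d \<Rightarrow> 'j set) \<Rightarrow> 'd \<Rightarrow> ('j \<Rightarrow> real) \<Rightarrow> real" where
  "G J d \<alpha> = (\<Sum>j\<in>J d. - ln (1 - \<alpha> j))"

definition F :: "'d set \<Rightarrow> ('d \<Rightarrow> 'j set) \<Rightarrow> ('j \<Rightarrow> real) \<Rightarrow> ('j \<Rightarrow> real) \<Rightarrow> real" where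
  "F D J \<sigma> \<alpha> = (\<Sum>d\<in>D. W J \<sigma> d \<alpha>)"

definition optimal_M1 ::
  "'d set \<Rightarrow> ('d \<Rightarrow> 'j set) \<Rightarrow> ('j \<Rightarrow> real) \<Rightarrow> ('j \<Rightarrow> real) \<Rightarrow> ('j \<Rightarrow> real) \<Rightarrow> real
    \<Rightarrow> ('j \<Rightarrow> real) \<Rightarrow> bool" where
  "optimal_M1 D J \<sigma> lo hi w \<alpha> \<longleftrightarrow>
     is_arg_min (\<lambda>a. F D J \<sigma> a + w / real (card D) * (\<Sum>d\<in>D. G J d a))
       (\<lambda>a. a \<in> alpha_box D J lo hi) \<alpha>"

definition optimal_M2 ::
  "'d set \<Rightarrow> ('d \<Rightarrow> 'j set) \<Rightarrow> ('j \<Rightarrow> real) \<Rightarrow> ('j \<Rightarrow> real) \<Rightarrow> ('j \<Rightarrow> real) \<Rightarrow> real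
    \<Rightarrow> ('j \<Rightarrow> real) \<Rightarrow> real \<Rightarrow> bool" where
  "optimal_M2 D J \<sigma> lo hi w \<alpha> r \<longleftrightarrow>
     is_arg_min (\<lambda>(a, s). F D J \<sigma> a + w * s)
       (\<lambda>(a, s). a \<in> alpha_box D J lo hi \<and> (\<forall>d\<in>D. G J d a \<le> s)) (\<alpha>, r)"

definition optimal_M3 ::
  "'d set \<Rightarrow> ('d \<Rightarrow> 'j set) \<Rightarrow> ('j \<Rightarrow> real) \<Rightarrow> ('j \<Rightarrow> real) \<Rightarrow> ('j \<Rightarrow> real) \<Rightarrow> ('d \<Rightarrow> real)
    \<Rightarrow> ('j \<Rightarrow> real) \<Rightarrow> bool" where
  "optimal_M3 D J \<sigma> lo hi B \<alpha> \<longleftrightarrow>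
     is_arg_min (F D J \<sigma>)
       (\<lambda>a. a \<in> alpha_box D J lo hi \<and> (\<forall>d\<in>D. G J d a \<le> B d)) \<alpha>"

text \<open>The KKT systems below are the first-order ones. The bounds of the box are inequality
  constraints with their own multipliers: \<open>\<mu> j\<close> for \<open>lo j - a j \<le> 0\<close> and \<open>\<nu> j\<close> for
  \<open>a j - hi j \<le> 0\<close>. Stationarity is the vanishing of every partial derivative of the
  Lagrangian.\<close>

definition stationary_in :: "'j set \<Rightarrow> (('j \<Rightarrow> real) \<Rightarrow> real) \<Rightarrow> ('j \<Rightarrow> real) \<Rightarrow> bool" where
  "stationary_in V L \<alpha> \<longleftrightarrow>
     (\<forall>j\<in>V. ((\<lambda>t. L (\<alpha>(j := t))) has_real_derivative 0) (at (\<alpha> j)))"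

definition box_multipliers ::
  "'j set \<Rightarrow> ('j \<Rightarrow> real) \<Rightarrow> ('j \<Rightarrow> real) \<Rightarrow> ('j \<Rightarrow> real) \<Rightarrow> ('j \<Rightarrow> real) \<Rightarrow> ('j \<Rightarrow> real)
    \<Rightarrow> bool" where
  "box_multipliers V lo hi \<alpha> \<mu> \<nu> \<longleftrightarrow>
     (\<forall>j\<in>V. \<mu> j \<ge> 0 \<and> \<nu> j \<ge> 0 \<and> \<mu> j * (lo j - \<alpha> j) = 0 \<and> \<nu> j * (\<alpha> j - hi j) = 0)"

definition box_term ::
  "'j set \<Rightarrow> ('j \<Rightarrow> real) \<Rightarrow> ('j \<Rightarrow> real) \<Rightarrow> ('j \<Rightarrow> real) \<Rightarrow> ('j \<Rightarrow> real) \<Rightarrow> ('j \<Rightarrow> real)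
    \<Rightarrow> real" where
  "box_term V lo hi \<mu> \<nu> a = (\<Sum>j\<in>V. \<mu> j * (lo j - a j) + \<nu> j * (a j - hi j))"

definition lagrangian_M2 ::
  "'d set \<Rightarrow> ('d \<Rightarrow> 'j set) \<Rightarrow> ('j \<Rightarrow> real) \<Rightarrow> ('j \<Rightarrow> real) \<Rightarrow> ('j \<Rightarrow> real) \<Rightarrow> real
    \<Rightarrow> ('d \<Rightarrow> real) \<Rightarrow> ('j \<Rightarrow> real) \<Rightarrow> ('j \<Rightarrow> real) \<Rightarrow> ('j \<Rightarrow> real) \<Rightarrow> real \<Rightarrow> real" where
  "lagrangian_M2 D J \<sigma> lo hi w \<eta> \<mu> \<nu> a s =
     F D J \<sigma> a + w * s + (\<Sum>d\<in>D. \<eta> d * (G J d a - s))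
       + box_term (surgeries D J) lo hi \<mu> \<nu> a"

definition kkt_M2 ::
  "'d set \<Rightarrow> ('d \<Rightarrow> 'j set) \<Rightarrow> ('j \<Rightarrow> real) \<Rightarrow> ('j \<Rightarrow> real) \<Rightarrow> ('j \<Rightarrow> real) \<Rightarrow> real
    \<Rightarrow> ('j \<Rightarrow> real) \<Rightarrow> real \<Rightarrow> ('d \<Rightarrow> real) \<Rightarrow> bool" where
  "kkt_M2 D J \<sigma> lo hi w \<alpha> r \<eta> \<longleftrightarrow>
     \<alpha> \<in> alpha_box D J lo hi \<and> (\<forall>d\<in>D. G J d \<alpha> \<le> r) \<and>
     (\<forall>d\<in>D. \<eta> d \<ge> 0 \<and> \<eta> d * (G J d \<alpha> - r) = 0) \<and>
     (\<exists>\<mu> \<nu>. box_multipliers (surgeries D J) lo hi \<alpha> \<mu> \<nu> \<and>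
        stationary_in (surgeries D J)
          (\<lambda>a. lagrangian_M2 D J \<sigma> lo hi w \<eta> \<mu> \<nu> a r) \<alpha> \<and>
        ((\<lambda>s. lagrangian_M2 D J \<sigma> lo hi w \<eta> \<mu> \<nu> \<alpha> s) has_real_derivative 0) (at r))"

definition lagrangian_M3 ::
  "'d set \<Rightarrow> ('d \<Rightarrow> 'j set) \<Rightarrow> ('j \<Rightarrow> real) \<Rightarrow> ('j \<Rightarrow> real) \<Rightarrow> ('j \<Rightarrow> real) \<Rightarrow> ('d \<Rightarrow> real)
    \<Rightarrow> ('d \<Rightarrow> real) \<Rightarrow> ('j \<Rightarrow> real) \<Rightarrow> ('j \<Rightarrow> real) \<Rightarrow> ('j \<Rightarrow> real) \<Rightarrow> real" where
  "lagrangian_M3 D J \<sigma> lo hi B \<xi> \<mu> \<nu> a =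
     F D J \<sigma> a + (\<Sum>d\<in>D. \<xi> d * (G J d a - B d))
       + box_term (surgeries D J) lo hi \<mu> \<nu> a"

definition kkt_M3 ::
  "'d set \<Rightarrow> ('d \<Rightarrow> 'j set) \<Rightarrow> ('j \<Rightarrow> real) \<Rightarrow> ('j \<Rightarrow> real) \<Rightarrow> ('j \<Rightarrow> real) \<Rightarrow> ('d \<Rightarrow> real)
    \<Rightarrow> ('j \<Rightarrow> real) \<Rightarrow> ('d \<Rightarrow> real) \<Rightarrow> bool" where
  "kkt_M3 D J \<sigma> lo hi B \<alpha> \<xi> \<longleftrightarrow>
     \<alpha> \<in> alpha_box D J lo hi \<and> (\<forall>d\<in>D. G J d \<alpha> \<le> B d) \<and>
     (\<forall>d\<in>D. \<xi> d \<ge> 0 \<and> \<xi> d * (G J d \<alpha> - B d) = 0) \<and>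
     (\<exists>\<mu> \<nu>. box_multipliers (surgeries D J) lo hi \<alpha> \<mu> \<nu> \<and>
        stationary_in (surgeries D J) (lagrangian_M3 D J \<sigma> lo hi B \<xi> \<mu> \<nu>) \<alpha>)"

definition is_interior :: "('j \<Rightarrow> real) \<Rightarrow> ('j \<Rightarrow> real) \<Rightarrow> ('j \<Rightarrow> real) \<Rightarrow> 'j \<Rightarrow> bool" where
  "is_interior lo hi \<alpha> j \<longleftrightarrow> lo j < \<alpha> j \<and> \<alpha> j < hi j"

text \<open>The third conjunct of the first part is the equivalence of the two forms of the rule; the
  second part is the sense in which days of zero price are boundary cases.\<close>

definition interior_rule ::
  "('d \<Rightarrow> 'j set) \<Rightarrow> ('j \<Rightarrow> real) \<Rightarrow> ('j \<Rightarrow> real) \<Rightarrow> ('j \<Rightarrow> real) \<Rightarrow> ('j \<Rightarrow> real) \<Rightarrow> 'd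
    \<Rightarrow> real \<Rightarrow> bool" where
  "interior_rule J \<sigma> lo hi \<alpha> d price \<longleftrightarrow>
     (price > 0 \<longrightarrow>
        (\<forall>j\<in>J d. is_interior lo hi \<alpha> j \<longrightarrow>
           \<sigma> j * phi (\<alpha> j) = price \<and> \<alpha> j = phi_inv (price / \<sigma> j) \<and>
           (\<forall>a\<in>{0<..<1}. \<sigma> j * phi a = price \<longleftrightarrow> a = phi_inv (price / \<sigma> j)))) \<and>
     (price = 0 \<longrightarrow> (\<forall>j\<in>J d. \<not> is_interior lo hi \<alpha> j))"

end

(* Since kappa' a = - phi a / (1 - a) and (- ln (1 - a))' = 1 / (1 - a), pricing reliability on
   day d at lambda makes the partial derivative of the objective in a surgery j of that day equal to
   (lambda - sigma j * phi (alpha j)) / (1 - alpha j). It vanishes at an interior surgery: by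
   Fermat's rule in M1, and by stationarity of the Lagrangian with zero box multipliers in M2, M3.
   Positivity of phi then excludes interior surgeries on days of price zero. *)
theory Submission
  imports Defs
begin

lemma phi_pos: "phi a > 0" if "0 < a" "a < 1"
  using that by (simp add: phi_def)

lemma phi_strict_antimono: "phi b < phi a" if "0 < a" "a < b" "b < 1"
  unfolding phi_def using that
  by (intro frac_less mult_strict_left_mono mult_left_mono powr_mono2 powr_less_mono2) auto

lemma inj_on_phi: "inj_on phi {0<..<1}"
  by (rule linorder_inj_onI) (use phi_strict_antimono in fastforce)+

lemma phi_inv_phi: "phi_inv (phi a) = a" if "0 < a" "a < 1"
  unfolding phi_inv_def using that by (intro the_inv_into_f_f inj_on_phi) auto

lemma kappa_has_derivative:
  assumes "0 < a" "a < 1"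
  shows "(kappa has_real_derivative - phi a / (1 - a)) (at a)"
proof -
  have pos: "(1 - a) / a > 0" using assms by simp
  have "((\<lambda>x. sqrt ((1 - x) / x)) has_real_derivative
      inverse (sqrt ((1 - a) / a)) / 2 * ((- 1 * a - (1 - a) * 1) / (a * a))) (at a)"
    by (rule DERIV_chain2[where f = sqrt and g = "\<lambda>x. (1 - x) / x" and x = a, OF DERIV_real_sqrt[OF pos]]) (use assms in \<open>auto intro!: derivative_eq_intros\<close>)
  \<comment> \<open>Powers become square roots, so that \<open>phi\<close> can be compared with the
    output of the chain rule; both sides of the last identity equal -1 / (2 * a * sqrt a * sqrt (1 -
    a)).\<close>
  moreover have "a powr (3/2) = a * sqrt a"
    using assms powr_add[of a 1 "1/2"] by (simp add: powr_half_sqrt)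
  then have "phi a = sqrt (1 - a) / (2 * (a * sqrt a))"
    using assms by (simp add: phi_def powr_half_sqrt)
  moreover have "inverse (sqrt ((1 - a) / a)) / 2 * ((- 1 * a - (1 - a) * 1) / (a * a))
      = - (sqrt (1 - a) / (2 * (a * sqrt a))) / (1 - a)"
    using assms by (simp add: real_sqrt_divide divide_simps) (simp flip: mult.assoc)
  ultimately show ?thesis
    by (simp add: kappa_def[abs_def])
qed

text \<open>In a separable sum, only the summand of index \<open>j\<close> varies with coordinate
  \<open>j\<close>. The case distinction lets the same fact serve the sums over each day and over
  all surgeries.\<close>

lemma has_derivative_sum_fun_upd:
  fixes \<alpha> :: "'j \<Rightarrow> real"
  assumes "finite A" "(f j has_real_derivative y) (at (\<alpha> j))"
  shows "((\<lambda>t. \<Sum>i\<in>A. f i ((\<alpha>(j := t)) i)) has_real_derivative (if j \<in> A then y else 0)) (at (\<alpha> j))"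
proof -
  have "((\<lambda>t. f i ((\<alpha>(j := t)) i)) has_real_derivative (if i = j then y else 0)) (at (\<alpha> j))" for i
    using assms(2) by (cases "i = j") simp_all
  then have "((\<lambda>t. \<Sum>i\<in>A. f i ((\<alpha>(j := t)) i)) has_real_derivative
      (\<Sum>i\<in>A. if i = j then y else 0)) (at (\<alpha> j))"
    by (intro DERIV_sum)
  then show ?thesis using assms(1) by (simp add: sum.delta)
qed

text \<open>The day-dependent prices \<open>c\<close> cover all three models: a constant in M1,
  \<eta> in M2 and \<xi> in M3.\<close>

lemma priced_objective_has_derivative:
  assumes D: "finite D" "\<forall>d\<in>D. finite (J d)" "disjoint_family_on J D"
    and j: "d \<in> D" "j \<in> J d" and a: "0 < \<alpha> j" "\<alpha> j < 1"
  shows "((\<lambda>t. F D J \<sigma> (\<alpha>(j := t)) + (\<Sum>e\<in>D. c e * G J e (\<alpha>(j := t)))) has_real_derivative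
      (c d - \<sigma> j * phi (\<alpha> j)) / (1 - \<alpha> j)) (at (\<alpha> j))"
proof -
  let ?y = "(c d - \<sigma> j * phi (\<alpha> j)) / (1 - \<alpha> j)"
  \<comment> \<open>Disjointness of the days: changing coordinate \<open>j\<close> affects the terms
    of day \<open>d\<close> alone, so only the price \<open>c d\<close> survives.\<close>
  have mem: "j \<in> J e \<longleftrightarrow> e = d" if "e \<in> D" for e
    using D(3) j that by (auto simp: disjoint_family_on_def)
  have "((\<lambda>t. W J \<sigma> e (\<alpha>(j := t)) + c e * G J e (\<alpha>(j := t))) has_real_derivative
      (if e = d then ?y else 0)) (at (\<alpha> j))" if "e \<in> D" for e
  proof -
    have "((\<lambda>t. W J \<sigma> e (\<alpha>(j := t))) has_real_derivative
        (if j \<in> J e then \<sigma> j * (- phi (\<alpha> j) / (1 - \<alpha> j)) else 0)) (at (\<alpha> j))"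
      unfolding W_def using bspec[OF D(2) that]
      by (rule has_derivative_sum_fun_upd[where f = "\<lambda>i t. \<sigma> i * kappa t"])
        (intro DERIV_cmult kappa_has_derivative a)
    moreover have "((\<lambda>t. G J e (\<alpha>(j := t))) has_real_derivative
        (if j \<in> J e then 1 / (1 - \<alpha> j) else 0)) (at (\<alpha> j))"
      unfolding G_def using bspec[OF D(2) that]
      by (rule has_derivative_sum_fun_upd[where f = "\<lambda>i t. - ln (1 - t)"])
        (use a in \<open>auto intro!: derivative_eq_intros\<close>)
    ultimately have "((\<lambda>t. W J \<sigma> e (\<alpha>(j := t)) + c e * G J e (\<alpha>(j := t))) has_real_derivative
        (if j \<in> J e then \<sigma> j * (- phi (\<alpha> j) / (1 - \<alpha> j)) else 0)
          + c e * (if j \<in> J e then 1 / (1 - \<alpha> j) else 0)) (at (\<alpha> j))"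
      by (intro DERIV_add DERIV_cmult)
    then show ?thesis
      using mem[OF that] a by (cases "e = d") (simp_all add: diff_divide_distrib)
  qed
  then have "((\<lambda>t. \<Sum>e\<in>D. W J \<sigma> e (\<alpha>(j := t)) + c e * G J e (\<alpha>(j := t))) has_real_derivative
      (\<Sum>e\<in>D. if e = d then ?y else 0)) (at (\<alpha> j))"
    by (intro DERIV_sum)
  then show ?thesis
    using D(1) j(1) by (simp add: F_def sum.distrib sum.delta)
qed

text \<open>Shared by M2 and M3: \<open>k\<close> collects the part of the Lagrangian that is
  constant in the tail probabilities, and hence has zero derivative.\<close>

lemma interior_price_of_stationary:
  assumes D: "finite D" "\<forall>d\<in>D. finite (J d)" "disjoint_family_on J D"
    and j: "d \<in> D" "j \<in> J d" and a: "0 < \<alpha> j" "\<alpha> j < 1"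
    and int: "is_interior lo hi \<alpha> j"
    and box: "box_multipliers (surgeries D J) lo hi \<alpha> \<mu> \<nu>"
    and stat: "stationary_in (surgeries D J) L \<alpha>"
    and L: "\<And>a. L a = F D J \<sigma> a + (\<Sum>e\<in>D. c e * G J e a)
              + box_term (surgeries D J) lo hi \<mu> \<nu> a + k"
  shows "\<sigma> j * phi (\<alpha> j) = c d"
proof -
  have jV: "j \<in> surgeries D J" and fin: "finite (surgeries D J)"
    using D j by (auto simp: surgeries_def)
  \<comment> \<open>Complementary slackness: neither bound is attained at an interior
    surgery.\<close>
  have "\<mu> j = 0" "\<nu> j = 0"
    using box jV int by (auto simp: box_multipliers_def is_interior_def)
  then have "((\<lambda>t. box_term (surgeries D J) lo hi \<mu> \<nu> (\<alpha>(j := t))) has_real_derivative 0) (at (\<alpha> j))"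
    unfolding box_term_def
    using has_derivative_sum_fun_upd[OF fin, of "\<lambda>i t. \<mu> i * (lo i - t) + \<nu> i * (t - hi i)" j 0 \<alpha>]
    by simp
  then have "((\<lambda>t. L (\<alpha>(j := t))) has_real_derivative
      (c d - \<sigma> j * phi (\<alpha> j)) / (1 - \<alpha> j) + 0 + 0) (at (\<alpha> j))"
    unfolding L using priced_objective_has_derivative[where \<alpha> = \<alpha>, OF D j a]
    by (intro DERIV_add DERIV_const)
  moreover have "((\<lambda>t. L (\<alpha>(j := t))) has_real_derivative 0) (at (\<alpha> j))"
    using stat jV by (simp add: stationary_in_def)
  \<comment> \<open>Two derivatives of the same function at the same point must agree.\<close>
  ultimately have "(c d - \<sigma> j * phi (\<alpha> j)) / (1 - \<alpha> j) = 0"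
    using DERIV_unique by fastforce
  then show ?thesis using a by simp
qed

text \<open>In M1 the box is the only constraint, so an interior coordinate may be moved alone in
  both directions; the minimum is then a local minimum in that coordinate, and Fermat's rule applies
  without multipliers.\<close>

lemma interior_price_of_optimal_M1:
  assumes D: "finite D" "\<forall>d\<in>D. finite (J d)" "disjoint_family_on J D"
    and j: "d \<in> D" "j \<in> J d" and a: "0 < \<alpha> j" "\<alpha> j < 1"
    and int: "is_interior lo hi \<alpha> j"
    and opt: "optimal_M1 D J \<sigma> lo hi w \<alpha>"
  shows "\<sigma> j * phi (\<alpha> j) = w / real (card D)"
proof -
  define f where "f x = F D J \<sigma> x + (\<Sum>e\<in>D. w / real (card D) * G J e x)" for x
  have min: "\<alpha> \<in> alpha_box D J lo hi" "\<And>y. y \<in> alpha_box D J lo hi \<Longrightarrow> f \<alpha> \<le> f y"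
    using opt unfolding optimal_M1_def is_arg_min_def f_def
    by (auto simp: sum_distrib_left not_less)
  have jV: "j \<in> surgeries D J" using j by (auto simp: surgeries_def)
  \<comment> \<open>The distance from the coordinate to the nearer bound: any smaller displacement
    stays in the box.\<close>
  define e where "e = min (\<alpha> j - lo j) (hi j - \<alpha> j)"
  \<comment> \<open>The trivial update on the left is \<alpha> itself, written as the value at
    \<alpha> j of the one-variable function to be differentiated.\<close>
  have "\<forall>t. \<bar>\<alpha> j - t\<bar> < e \<longrightarrow> f (\<alpha>(j := \<alpha> j)) \<le> f (\<alpha>(j := t))"
  proof (intro allI impI)
    fix t assume "\<bar>\<alpha> j - t\<bar> < e"
    then have "lo j \<le> t" "t \<le> hi j" unfolding e_def by linarith+
    then have "\<alpha>(j := t) \<in> alpha_box D J lo hi"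
      using min(1) jV by (auto simp: alpha_box_def PiE_iff extensional_def)
    then show "f (\<alpha>(j := \<alpha> j)) \<le> f (\<alpha>(j := t))" using min(2) by simp
  qed
  moreover have "e > 0" using int by (simp add: e_def is_interior_def)
  ultimately have "(w / real (card D) - \<sigma> j * phi (\<alpha> j)) / (1 - \<alpha> j) = 0"
    using DERIV_local_min[OF priced_objective_has_derivative[where \<alpha> = \<alpha> and \<sigma> = \<sigma>
          and c = "\<lambda>_. w / real (card D)", OF D j a]]
    unfolding f_def by blast
  then show ?thesis using a by simp
qed

text \<open>One equation yields both halves of the rule: for a positive price it is the rule itself,
  and for price zero it contradicts the positivity of \<sigma> j and \<open>phi\<close>.\<close>

lemma interior_ruleI:
  assumes "\<And>j. j \<in> J d \<Longrightarrow> is_interior lo hi \<alpha> j \<Longrightarrow>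
      0 < \<sigma> j \<and> 0 < \<alpha> j \<and> \<alpha> j < 1 \<and> \<sigma> j * phi (\<alpha> j) = price"
  shows "interior_rule J \<sigma> lo hi \<alpha> d price"
  unfolding interior_rule_def
proof (intro conjI impI ballI)
  fix j assume "j \<in> J d" "is_interior lo hi \<alpha> j"
  note j = assms[OF this]
  show eq: "\<sigma> j * phi (\<alpha> j) = price" using j by simp
  then have quot: "price / \<sigma> j = phi (\<alpha> j)" using j by (simp add: field_simps)
  then show inv: "\<alpha> j = phi_inv (price / \<sigma> j)" using j phi_inv_phi by simp
  fix a :: real assume a: "a \<in> {0<..<1}"
  show "\<sigma> j * phi a = price \<longleftrightarrow> a = phi_inv (price / \<sigma> j)"
  proof
    assume "\<sigma> j * phi a = price"
    then have "price / \<sigma> j = phi a" using j by (simp add: field_simps)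
    then show "a = phi_inv (price / \<sigma> j)" using a phi_inv_phi by simp
  \<comment> \<open>Conversely, \<open>inv\<close> identifies \<open>a\<close> with \<alpha> j, for
    which the equation is already known.\<close>
  qed (use eq inv in simp)
next
  fix j assume "price = 0" "j \<in> J d"
  then show "\<not> is_interior lo hi \<alpha> j"
    using assms[of j] phi_pos[of "\<alpha> j"] by auto
qed

theorem mainTheorem2:
  fixes D :: "'d set" and J :: "'d \<Rightarrow> 'j set"
    and \<sigma> lo hi :: "'j \<Rightarrow> real" and w :: real and B :: "'d \<Rightarrow> real"
    and \<alpha> :: "'j \<Rightarrow> real"
  assumes "finite D" and "D \<noteq> {}"
    and "\<And>d. d \<in> D \<Longrightarrow> finite (J d)"
    and "disjoint_family_on J D"
    and "\<And>j. j \<in> surgeries D J \<Longrightarrow> \<sigma> j > 0"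
    and "\<And>j. j \<in> surgeries D J \<Longrightarrow> 0 < lo j \<and> lo j < hi j \<and> hi j < 1"
  shows "(optimal_M1 D J \<sigma> lo hi w \<alpha> \<longrightarrow>
            (\<forall>d\<in>D. interior_rule J \<sigma> lo hi \<alpha> d (w / real (card D)))) \<and>
         (\<forall>r \<eta>. optimal_M2 D J \<sigma> lo hi w \<alpha> r \<and> kkt_M2 D J \<sigma> lo hi w \<alpha> r \<eta> \<longrightarrow>
            (\<forall>d\<in>D. \<eta> d \<ge> 0) \<and> (\<Sum>d\<in>D. \<eta> d) = w \<and>
            (\<forall>d\<in>D. \<eta> d * (G J d \<alpha> - r) = 0) \<and>
            (\<forall>d\<in>D. interior_rule J \<sigma> lo hi \<alpha> d (\<eta> d))) \<and>
         (\<forall>\<xi>. optimal_M3 D J \<sigma> lo hi B \<alpha> \<and> kkt_M3 D J \<sigma> lo hi B \<alpha> \<xi> \<longrightarrow>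
            (\<forall>d\<in>D. \<xi> d \<ge> 0) \<and>
            (\<forall>d\<in>D. \<xi> d * (G J d \<alpha> - B d) = 0) \<and>
            (\<forall>d\<in>D. interior_rule J \<sigma> lo hi \<alpha> d (\<xi> d)))"
proof -
  have D: "finite D" "\<forall>d\<in>D. finite (J d)" "disjoint_family_on J D"
    using assms(1,3,4) by blast+
  have surg: "j \<in> surgeries D J" if "d \<in> D" "j \<in> J d" for d j
    using that by (auto simp: surgeries_def)
  have inside: "0 < \<sigma> j \<and> 0 < \<alpha> j \<and> \<alpha> j < 1" if "d \<in> D" "j \<in> J d" "is_interior lo hi \<alpha> j" for d j
    using assms(5,6)[OF surg[OF that(1,2)]] that(3) by (auto simp: is_interior_def)
  have M1: "interior_rule J \<sigma> lo hi \<alpha> d (w / real (card D))"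
    if "optimal_M1 D J \<sigma> lo hi w \<alpha>" "d \<in> D" for d
    using inside[OF that(2)] interior_price_of_optimal_M1[OF D that(2) _ _ _ _ that(1)]
    by (intro interior_ruleI) blast
  have M2: "(\<Sum>d\<in>D. \<eta> d) = w \<and> (\<forall>d\<in>D. interior_rule J \<sigma> lo hi \<alpha> d (\<eta> d))"
    if kkt: "kkt_M2 D J \<sigma> lo hi w \<alpha> r \<eta>" for r \<eta>
  proof -
    obtain \<mu> \<nu> where box: "box_multipliers (surgeries D J) lo hi \<alpha> \<mu> \<nu>"
      and stat: "stationary_in (surgeries D J)
          (\<lambda>a. lagrangian_M2 D J \<sigma> lo hi w \<eta> \<mu> \<nu> a r) \<alpha>"
      and stat_r: "((\<lambda>s. lagrangian_M2 D J \<sigma> lo hi w \<eta> \<mu> \<nu> \<alpha> s) has_real_derivative 0) (at r)"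
      using kkt unfolding kkt_M2_def by blast
    \<comment> \<open>In the variable r the Lagrangian is affine with slope w minus the total of
      \<eta>; stationarity in r makes this slope vanish.\<close>
    have "((\<lambda>s. lagrangian_M2 D J \<sigma> lo hi w \<eta> \<mu> \<nu> \<alpha> s) has_real_derivative
        w - (\<Sum>d\<in>D. \<eta> d)) (at r)"
      unfolding lagrangian_M2_def
      by (auto intro!: derivative_eq_intros simp: sum_negf)
    then have "(\<Sum>d\<in>D. \<eta> d) = w" using DERIV_unique[OF stat_r] by fastforce
    \<comment> \<open>With r held fixed, the terms free of \<open>a\<close> are gathered into the
      constant \<open>k\<close> of the stationarity lemma.\<close>
    moreover have "lagrangian_M2 D J \<sigma> lo hi w \<eta> \<mu> \<nu> a r
        = F D J \<sigma> a + (\<Sum>d\<in>D. \<eta> d * G J d a) + box_term (surgeries D J) lo hi \<mu> \<nu> a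
          + (w * r - (\<Sum>d\<in>D. \<eta> d * r))" for a
      by (simp add: lagrangian_M2_def right_diff_distrib sum_subtractf)
    note price = interior_price_of_stationary[OF D _ _ _ _ _ box stat this]
    have "interior_rule J \<sigma> lo hi \<alpha> d (\<eta> d)" if "d \<in> D" for d
      using inside[OF that] price[OF that] by (intro interior_ruleI) blast
    ultimately show ?thesis by blast
  qed
  have M3: "\<forall>d\<in>D. interior_rule J \<sigma> lo hi \<alpha> d (\<xi> d)"
    if kkt: "kkt_M3 D J \<sigma> lo hi B \<alpha> \<xi>" for \<xi>
  proof -
    obtain \<mu> \<nu> where box: "box_multipliers (surgeries D J) lo hi \<alpha> \<mu> \<nu>"
      and stat: "stationary_in (surgeries D J) (lagrangian_M3 D J \<sigma> lo hi B \<xi> \<mu> \<nu>) \<alpha>"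
      using kkt unfolding kkt_M3_def by blast
    have "lagrangian_M3 D J \<sigma> lo hi B \<xi> \<mu> \<nu> a
        = F D J \<sigma> a + (\<Sum>d\<in>D. \<xi> d * G J d a) + box_term (surgeries D J) lo hi \<mu> \<nu> a
          + - (\<Sum>d\<in>D. \<xi> d * B d)" for a
      by (simp add: lagrangian_M3_def right_diff_distrib sum_subtractf)
    note price = interior_price_of_stationary[OF D _ _ _ _ _ box stat this]
    have "interior_rule J \<sigma> lo hi \<alpha> d (\<xi> d)" if "d \<in> D" for d
      using inside[OF that] price[OF that] by (intro interior_ruleI) blast
    then show ?thesis by blast
  qed
  \<comment> \<open>The signs of the multipliers and the complementary slackness conditions are read
    off from the KKT systems.\<close>
  show ?thesis
    using M1 M2 M3 unfolding kkt_M2_def[of D J \<sigma> lo hi w \<alpha>] kkt_M3_def[of D J \<sigma> lo hi B \<alpha>]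
    by blast
qed

end
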